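(* Let $(X,d,\preceq)$ be an ordered metric space, let $E$ be an $\mathrm O$-complete subspace of $X$, and let $\ast\in\mathfrak B_n$. Let $F:X^n\to X$ and $g:X\to X$ be two mappings. Suppose that the following conditions hold: (i) $F(X^n)\subseteq g(X)\cap E$; (ii) $F$ has the $g$-monotone property; (iii) $F$ and $g$ are $(\ast,\mathrm O)$-compatible; (iv) $g$ is $\mathrm O$-continuous; (v) either $F$ is $\mathrm O$-continuous or $(E,d,\preceq)$ has the $g$-MCB property; (vi$''$) there exist $x^{(0)}_1,\dots,x^{(0)}_n\in X$ such that either $g(x^{(0)}_i)\preceq F(x^{(0)}_{i_1},\dots,x^{(0)}_{i_n})$ for each $i\in I_n$, or $g(x^{(0)}_i)\succeq F(x^{(0)}_{i_1},\dots,x^{(0)}_{i_n})$ for each $i\in I_n$; (vii) there exists $\varphi\in\Omega$ such that $$\frac1n\sum_{i=1}^n d\big(F(x_{i_1},\dots,x_{i_n}),F(y_{i_1},\dots,y_{i_n})\big)\le\varphi\Big(\frac1n\sum_{i=1}^n d(gx_i,gy_i)\Big)$$ for all $x_1,\dots,x_n,y_1,\dots,y_n\in X$ with [$g(x_i)\preceq g(y_i)$ for each $i\in I_n$] or [$g(x_i)\succeq g(y_i)$ for each $i\in I_n$]; or, alternatively to (vii), (vii$'$) there exists $\varphi\in\Omega$ such that $$\max_{i\in I_n} d\big(F(x_{i_1},\dots,x_{i_n}),F(y_{i_1},\dots,y_{i_n})\big)\le\varphi\Big(\max_{i\in I_n} d(gx_i,gy_i)\Big)$$ for all $x_1,\dots,x_n,y_1,\dots,y_n\in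 X$ with [$g(x_i)\preceq g(y_i)$ for each $i\in I_n$] or [$g(x_i)\succeq g(y_i)$ for each $i\in I_n$]. Then $F$ and $g$ have an $\ast$-coincidence point.
   Context: Throughout, $n\ge 2$ is a fixed integer, $I_n=\{1,\dots,n\}$, and sequences are indexed by $m\in\mathbb N_0$. An ordered metric space $(X,d,\preceq)$ is a nonempty set $X$ with a metric $d$ and a partial order $\preceq$; $x\succeq y$ means $y\preceq x$. A subspace is a nonempty subset with the restricted metric and order. We write $gx$ for $g(x)$. $\mathfrak B_n$ is the set of all binary operations $\ast:I_n\times I_n\to I_n$; for $\ast\in\mathfrak B_n$ write $i_k:=\ast(i,k)$. A sequence $\{x^{(m)}\}$ is increasing (decreasing) if $x^{(m)}\preceq x^{(m+1)}$ (resp. $x^{(m)}\succeq x^{(m+1)}$) for all $m$, and monotone if it is increasing or decreasing. $x^{(m)}\uparrow x$, $x^{(m)}\downarrow x$, $x^{(m)}\uparrow\downarrow x$ mean that $\{x^{(m)}\}$ converges to $x$ in $d$ and is, respectively, increasing, decreasing, monotone. $E$ is $\mathrm O$-complete if every monotone Cauchy sequence in $E$ converges in $E$. $g$ is $\mathrm O$-continuous if for every $x\in X$ and every sequence in $X$ with $x^{(m)}\uparrow\downarrow x$ one has $g(x^{(m)})\to g(x)$. $F$ is $\mathrm O$-continuous if for every $(x_1,\dots,x_n)\in X^n$ and all sequences $\{x_1^{(m)}\},\dots,\{x_n^{(m)}\}$ in $X$ with $x_i^{(m)}\uparrow\downarrow x_i$ for each $i$, one has $F(x_1^{(m)},\dots,x_n^{(m)})\to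 F(x_1,\dots,x_n)$. $(E,d,\preceq)$ has the $g$-MCB property if for every sequence $\{x^{(m)}\}$ in $E$ and $x\in E$: $x^{(m)}\uparrow x$ implies $g(x^{(m)})\preceq g(x)$ for all $m$, and $x^{(m)}\downarrow x$ implies $g(x^{(m)})\succeq g(x)$ for all $m$. $F$ has the $g$-monotone property if, for all $x_1,\dots,x_n,y_1,\dots,y_n\in X$, $g(x_i)\preceq g(y_i)$ for all $i\in I_n$ implies $F(x_1,\dots,x_n)\preceq F(y_1,\dots,y_n)$. $F$ and $g$ are $(\ast,\mathrm O)$-compatible if for any sequences $\{x_1^{(m)}\},\dots,\{x_n^{(m)}\}$ in $X$ and any $z_1,\dots,z_n\in X$ with $g(x_i^{(m)})\uparrow\downarrow z_i$ and $F(x_{i_1}^{(m)},\dots,x_{i_n}^{(m)})\uparrow\downarrow z_i$ for each $i\in I_n$, one has $\lim_{m\to\infty}d\big(gF(x_{i_1}^{(m)},\dots,x_{i_n}^{(m)}),F(gx_{i_1}^{(m)},\dots,gx_{i_n}^{(m)})\big)=0$ for each $i\in I_n$. $\Omega$ is the set of functions $\varphi:[0,\infty)\to[0,\infty)$ with $\varphi(t)<t$ and $\limsup_{r\to t^+}\varphi(r)<t$ for each $t>0$. $(x_1,\dots,x_n)\in X^n$ is an $\ast$-coincidence point of $F$ and $g$ if $F(x_{i_1},\dots,x_{i_n})=g(x_i)$ for each $i\in I_n$. *)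

theory Defs
  imports "HOL-Analysis.Analysis"
begin

text \<open>
  An ordered metric space is a type of class \<open>metric_space\<close> and \<open>order\<close>; no compatibility between
  metric and order is assumed.  The index set \<open>{1, \<dots>, n}\<close> is a finite type \<open>'n\<close> with
  \<open>CARD('n) = n\<close>, \<open>n\<close>-tuples are elements of \<open>'a ^ 'n\<close>, and a binary operation on the
  index set is a function \<open>'n \<Rightarrow> 'n \<Rightarrow> 'n\<close>.  A sequence of \<open>n\<close>-tuples encodes \<open>n\<close> sequences.
\<close>

definition incr_lim :: "(nat \<Rightarrow> 'a::{metric_space,order}) \<Rightarrow> 'a \<Rightarrow> bool" where
  "incr_lim u x \<longleftrightarrow> incseq u \<and> u \<longlonglongrightarrow> x"

definition decr_lim :: "(nat \<Rightarrow> 'a::{metric_space,order}) \<Rightarrow> 'a \<Rightarrow> bool" where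
  "decr_lim u x \<longleftrightarrow> decseq u \<and> u \<longlonglongrightarrow> x"

definition mono_lim :: "(nat \<Rightarrow> 'a::{metric_space,order}) \<Rightarrow> 'a \<Rightarrow> bool" where
  "mono_lim u x \<longleftrightarrow> monoseq u \<and> u \<longlonglongrightarrow> x"

definition O_complete :: "'a::{metric_space,order} set \<Rightarrow> bool" where
  "O_complete E \<longleftrightarrow>
     (\<forall>u. (\<forall>m. u m \<in> E) \<and> monoseq u \<and> Cauchy u \<longrightarrow> (\<exists>x\<in>E. u \<longlonglongrightarrow> x))"

definition O_continuous :: "('a::{metric_space,order} \<Rightarrow> 'a) \<Rightarrow> bool" where
  "O_continuous g \<longleftrightarrow> (\<forall>u x. mono_lim u x \<longrightarrow> (\<lambda>m. g (u m)) \<longlonglongrightarrow> g x)"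

text \<open>Different components of the tuple sequence may be monotone in different directions.\<close>

definition O_continuous_tuple :: "('a::{metric_space,order} ^ 'n \<Rightarrow> 'a) \<Rightarrow> bool" where
  "O_continuous_tuple F \<longleftrightarrow>
     (\<forall>u x. (\<forall>i. mono_lim (\<lambda>m. u m $ i) (x $ i)) \<longrightarrow> (\<lambda>m. F (u m)) \<longlonglongrightarrow> F x)"

definition MCB_property ::
  "('a::{metric_space,order} \<Rightarrow> 'a) \<Rightarrow> 'a set \<Rightarrow> bool" where
  "MCB_property g E \<longleftrightarrow>
     (\<forall>u x. (\<forall>m. u m \<in> E) \<and> x \<in> E \<longrightarrow>
        (incr_lim u x \<longrightarrow> (\<forall>m. g (u m) \<le> g x)) \<and>
        (decr_lim u x \<longrightarrow> (\<forall>m. g (u m) \<ge> g x)))"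

definition g_monotone ::
  "('a::order ^ 'n \<Rightarrow> 'a) \<Rightarrow> ('a \<Rightarrow> 'a) \<Rightarrow> bool" where
  "g_monotone F g \<longleftrightarrow> (\<forall>x y. (\<forall>i. g (x $ i) \<le> g (y $ i)) \<longrightarrow> F x \<le> F y)"

text \<open>\<open>reindex ast i x\<close> is the tuple \<open>(x\<^bsub>ast i 1\<^esub>, \<dots>, x\<^bsub>ast i n\<^esub>)\<close>.\<close>

definition reindex :: "('n \<Rightarrow> 'n \<Rightarrow> 'n) \<Rightarrow> 'n \<Rightarrow> 'a ^ 'n \<Rightarrow> 'a ^ 'n" where
  "reindex ast i x = (\<chi> k. x $ ast i k)"

definition O_compatible ::
  "('n \<Rightarrow> 'n \<Rightarrow> 'n) \<Rightarrow> ('a::{metric_space,order} ^ 'n \<Rightarrow> 'a) \<Rightarrow> ('a \<Rightarrow> 'a) \<Rightarrow> bool" where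
  "O_compatible ast F g \<longleftrightarrow>
     (\<forall>u z. (\<forall>i. mono_lim (\<lambda>m. g (u m $ i)) (z $ i) \<and>
                 mono_lim (\<lambda>m. F (reindex ast i (u m))) (z $ i)) \<longrightarrow>
        (\<forall>i. (\<lambda>m. dist (g (F (reindex ast i (u m))))
                        (F (reindex ast i (\<chi> k. g (u m $ k))))) \<longlonglongrightarrow> 0))"

text \<open>
  The functions are only relevant on \<open>[0, \<infinity>)\<close>.  The upper limit is taken in the extended reals,
  since it could otherwise fail to exist; \<open>at_right t\<close> excludes \<open>t\<close> itself.
\<close>

definition Omega :: "(real \<Rightarrow> real) set" where
  "Omega = {\<phi>. (\<forall>t\<ge>0. \<phi> t \<ge> 0) \<and>
               (\<forall>t>0. \<phi> t < t \<and> Limsup (at_right t) (\<lambda>r. ereal (\<phi> r)) < ereal t)}"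

definition coincidence_point ::
  "('n \<Rightarrow> 'n \<Rightarrow> 'n) \<Rightarrow> ('a ^ 'n \<Rightarrow> 'a) \<Rightarrow> ('a \<Rightarrow> 'a) \<Rightarrow> 'a ^ 'n \<Rightarrow> bool" where
  "coincidence_point ast F g x \<longleftrightarrow> (\<forall>i. F (reindex ast i x) = g (x $ i))"

end

theory Submission
  imports Defs
begin

text \<open>
  Write \<open>T x = (F (reindex ast i x))\<^sub>i\<close> and \<open>G x = (g (x\<^sub>i))\<^sub>i\<close>, so that an
  \<open>ast\<close>-coincidence point is a solution of \<open>T x = G x\<close>.  On the space of \<open>n\<close>-tuples with the
  componentwise order, \<open>T\<close> is monotone relative to \<open>G\<close>, and both contractivity hypotheses have the form
  \<open>D (T x) (T y) \<le> \<phi> (D (G x) (G y))\<close> for tuples with comparable images \<open>G x\<close>, \<open>G y\<close>; only the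
  distance \<open>D\<close> (mean or maximum of the component distances) differs.  The \<open>n\<close>-variable
  problem is thus a one-variable one, and it is treated for any \<open>D\<close> that is comparable with
  the component distances (locale \<open>tuple_distance\<close>).

  Since \<open>range F \<subseteq> range g\<close>, there are tuples with \<open>G (x (m+1)) = T (x m)\<close>.  The tuples
  \<open>G (x m)\<close> form a monotone chain, so the contraction applies to any two of them, and the gap below
  \<open>t\<close> that the upper limit condition leaves in the values of \<open>\<phi>\<close> to the right of \<open>t\<close> makes
  the chain Cauchy (\<open>comparison_contraction_Cauchy\<close>).  By completeness it converges to some \<open>z\<close>.
  Continuity of \<open>g\<close> gives \<open>G (T (x m)) \<longlonglongrightarrow> G z\<close>, and compatibility turns this into
  \<open>T (G (x m)) \<longlonglongrightarrow> G z\<close>.  Finally \<open>T (G (x m)) \<longlonglongrightarrow> T z\<close>: either directly by continuity of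
  \<open>F\<close>, or because the MCB property makes \<open>G (G (x m))\<close> comparable with \<open>G z\<close>, so that the
  contraction applies once more.  Hence \<open>T z = G z\<close>.
\<close>

section \<open>Comparison functions\<close>

text \<open>
  The upper limit controls \<open>\<phi>\<close> strictly to the right of \<open>t\<close> and \<open>\<phi> t < t\<close> controls it at
  \<open>t\<close>; together they give a uniform bound below \<open>t\<close> on a half-open interval.
\<close>

lemma Omega_gap:
  assumes "\<phi> \<in> Omega" "t > 0"
  obtains c \<eta> where "c < t" "\<eta> > 0" "\<And>r. t \<le> r \<Longrightarrow> r < t + \<eta> \<Longrightarrow> \<phi> r \<le> c"
proof -
  have lim: "Limsup (at_right t) (\<lambda>r. ereal (\<phi> r)) < ereal t" and at: "\<phi> t < t"
    using assms unfolding Omega_def by auto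
  obtain c where c: "Limsup (at_right t) (\<lambda>r. ereal (\<phi> r)) < ereal c" "c < t"
    using ereal_dense2[OF lim] by auto
  have "eventually (\<lambda>r. \<phi> r < c) (at_right t)"
    using Limsup_lessD[OF c(1)] by simp
  then obtain b where b: "b > t" "\<And>r. t < r \<Longrightarrow> r < b \<Longrightarrow> \<phi> r < c"
    unfolding eventually_at_right_field by blast
  have "\<phi> r \<le> max c (\<phi> t)" if "t \<le> r" "r < t + (b - t)" for r
    using b(2)[of r] that by (cases "r = t") auto
  moreover have "max c (\<phi> t) < t" "b - t > 0"
    using c at b by auto
  ultimately show thesis
    using that by blast
qed

lemma Omega_upd_zero:
  assumes "\<phi> \<in> Omega"
  shows "\<phi>(0 := 0) \<in> Omega"
proof -
  have "Limsup (at_right t) (\<lambda>r. ereal ((\<phi>(0 := 0)) r)) = Limsup (at_right t) (\<lambda>r. ereal (\<phi> r))"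
    if "t > 0" for t
  proof (rule Limsup_eq)
    show "\<forall>\<^sub>F r in at_right t. ereal ((\<phi>(0 := 0)) r) = ereal (\<phi> r)"
      using eventually_at_right_less[of t] by eventually_elim (use that in auto)
  qed
  then show ?thesis
    using assms unfolding Omega_def by auto
qed

lemma Omega_le:
  assumes "\<phi> \<in> Omega" "\<phi> 0 = 0" "t \<ge> 0"
  shows "\<phi> t \<le> t"
  using assms unfolding Omega_def by (cases "t = 0") (auto intro: less_imp_le)

text \<open>If the limit of such a sequence were \<open>L > 0\<close>, the sequence would enter the interval where
  \<open>\<phi>\<close> is bounded by some \<open>c < L\<close>, and drop below \<open>L\<close> at the next step.\<close>

lemma Omega_iterates_tendsto_zero:
  fixes \<delta> :: "nat \<Rightarrow> real"
  assumes "\<phi> \<in> Omega" "\<phi> 0 = 0" and nn: "\<And>m. \<delta> m \<ge> 0" and step: "\<And>m. \<delta> (Suc m) \<le> \<phi> (\<delta> m)"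
  shows "\<delta> \<longlonglongrightarrow> 0"
proof -
  have "decseq \<delta>"
    unfolding decseq_Suc_iff using order_trans[OF step Omega_le[OF assms(1,2) nn]] by blast
  then obtain L where L: "\<delta> \<longlonglongrightarrow> L" "\<And>m. L \<le> \<delta> m"
    using decseq_convergent[of \<delta> 0] nn by blast
  have "L \<ge> 0"
    using LIMSEQ_le_const[OF L(1)] nn by blast
  moreover have False if pos: "L > 0"
  proof -
    obtain c \<eta> where c: "c < L" "\<eta> > 0" "\<And>r. L \<le> r \<Longrightarrow> r < L + \<eta> \<Longrightarrow> \<phi> r \<le> c"
      using Omega_gap[OF assms(1) pos] by blast
    have "\<forall>\<^sub>F m in sequentially. \<delta> m < L + \<eta>"
      using order_tendstoD(2)[OF L(1), of "L + \<eta>"] c by simp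
    then obtain m where "\<delta> m < L + \<eta>"
      by (auto simp: eventually_sequentially)
    then have "\<delta> (Suc m) \<le> c"
      using order_trans[OF step c(3)[OF L(2)]] by blast
    then show False
      using L(2)[of "Suc m"] c(1) by simp
  qed
  ultimately have "L = 0"
    by fastforce
  then show ?thesis
    using L(1) by simp
qed

text \<open>
  With consecutive distances below \<open>s\<close>, a distance \<open>D (y m) (y (m + k)) < e\<close> grows to less than
  \<open>e + s\<close> when \<open>k\<close> is increased by one.  If it reached \<open>[e, e + s)\<close>, the gap of \<open>\<phi>\<close> would
  bring the distance of the successors down to \<open>c < e\<close>, and two short steps cannot bridge the
  difference \<open>e - c\<close>.  So the bound \<open>e\<close> persists for all \<open>k\<close>.
\<close>

lemma comparison_contraction_Cauchy:
  fixes D :: "'b \<Rightarrow> 'b \<Rightarrow> real"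
  assumes nn: "\<And>x y. D x y \<ge> 0" and refl: "\<And>x. D x x = 0" and sym: "\<And>x y. D x y = D y x"
    and tri: "\<And>x y z. D x z \<le> D x y + D y z"
    and phi: "\<phi> \<in> Omega" "\<phi> 0 = 0"
    and contr: "\<And>m k. m \<le> k \<Longrightarrow> D (y (Suc m)) (y (Suc k)) \<le> \<phi> (D (y m) (y k))"
    and e: "e > 0"
  shows "\<exists>N. \<forall>m\<ge>N. \<forall>k. D (y m) (y (m + k)) < e"
proof -
  obtain c \<eta> where c: "c < e" "\<eta> > 0" "\<And>r. e \<le> r \<Longrightarrow> r < e + \<eta> \<Longrightarrow> \<phi> r \<le> c"
    using Omega_gap[OF phi(1) e] by blast
  define s where "s = min \<eta> ((e - c) / 2)"
  have s: "s > 0" "s \<le> \<eta>" "2 * s \<le> e - c"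
    using c(1,2) unfolding s_def by (auto simp: min_def)
  have "(\<lambda>m. D (y m) (y (Suc m))) \<longlonglongrightarrow> 0"
    by (rule Omega_iterates_tendsto_zero[OF phi]) (use nn contr in auto)
  then have "\<forall>\<^sub>F m in sequentially. D (y m) (y (Suc m)) < s"
    using order_tendstoD(2) s(1) by blast
  then obtain N where N: "\<And>m. m \<ge> N \<Longrightarrow> D (y m) (y (Suc m)) < s"
    by (auto simp: eventually_sequentially)
  have "D (y m) (y (m + k)) < e" if m: "m \<ge> N" for m k
  proof (induction k)
    case 0
    then show ?case using refl e by simp
  next
    case (Suc k)
    let ?r = "D (y m) (y (Suc (m + k)))"
    have "?r < e"
    proof (rule ccontr)
      assume "\<not> ?r < e"
      moreover have "?r < e + \<eta>"
        using tri[of "y m" "y (Suc (m + k))" "y (m + k)"] Suc N[of "m + k"] m s(2) by simp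
      ultimately have "\<phi> ?r \<le> c"
        using c(3) by simp
      then have "D (y (Suc m)) (y (Suc (Suc (m + k)))) \<le> c"
        using contr[of m "Suc (m + k)"] by simp
      moreover have "?r \<le> D (y m) (y (Suc m)) + D (y (Suc m)) (y (Suc (Suc (m + k))))
          + D (y (Suc (m + k))) (y (Suc (Suc (m + k))))"
        using tri[of "y m" "y (Suc (m + k))" "y (Suc m)"]
          tri[of "y (Suc m)" "y (Suc (m + k))" "y (Suc (Suc (m + k)))"]
          sym[of "y (Suc (Suc (m + k)))" "y (Suc (m + k))"] by simp
      ultimately show False
        using N[of m] N[of "Suc (m + k)"] m s(3) \<open>\<not> ?r < e\<close> by simp
    qed
    then show ?case by simp
  qed
  then show ?thesis by blast
qed

section \<open>Distances on tuples\<close>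

text \<open>
  What the mean and the maximum of the component distances have in common.  The last two
  assumptions make \<open>D\<close>-convergence the same as componentwise convergence.
\<close>

locale tuple_distance =
  fixes D :: "'a::metric_space ^ 'n::finite \<Rightarrow> 'a ^ 'n \<Rightarrow> real"
  assumes sym: "D x y = D y x"
    and triangle: "D x z \<le> D x y + D y z"
    and le_sum: "D x y \<le> (\<Sum>i\<in>UNIV. dist (x $ i) (y $ i))"
    and component_le: "dist (x $ i) (y $ i) \<le> real CARD('n) * D x y"
begin

lemma nonneg: "D x y \<ge> 0"
proof -
  have "0 \<le> real CARD('n) * D x y"
    using order_trans[OF zero_le_dist component_le] .
  then show ?thesis
    by (simp add: zero_le_mult_iff)
qed

lemma self: "D x x = 0"
  using le_sum[of x x] nonneg[of x x] by simp

lemma eq_zero_iff: "D x y = 0 \<longleftrightarrow> x = y"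
proof
  assume "D x y = 0"
  then have "x $ i = y $ i" for i
    using component_le[where x = x and y = y and i = i] by simp
  then show "x = y"
    by (simp add: vec_eq_iff)
qed (simp add: self)

lemma tendsto_zero:
  assumes "\<And>i. (\<lambda>m. u m $ i) \<longlonglongrightarrow> x $ i"
  shows "(\<lambda>m. D (u m) x) \<longlonglongrightarrow> 0"
proof (rule tendsto_sandwich[of "\<lambda>_. 0" _ _ "\<lambda>m. \<Sum>i\<in>UNIV. dist (u m $ i) (x $ i)"])
  have "(\<lambda>m. \<Sum>i\<in>UNIV. dist (u m $ i) (x $ i)) \<longlonglongrightarrow> (\<Sum>i\<in>(UNIV::'n set). 0)"
    by (intro tendsto_sum) (simp add: assms tendsto_dist_iff[symmetric])
  then show "(\<lambda>m. \<Sum>i\<in>UNIV. dist (u m $ i) (x $ i)) \<longlonglongrightarrow> 0"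
    by simp
qed (auto simp: nonneg le_sum)

lemma component_tendsto:
  assumes "(\<lambda>m. D (u m) x) \<longlonglongrightarrow> 0"
  shows "(\<lambda>m. u m $ i) \<longlonglongrightarrow> x $ i"
proof -
  have "(\<lambda>m. real CARD('n) * D (u m) x) \<longlonglongrightarrow> 0"
    using tendsto_mult_right_zero[OF assms] .
  then have "(\<lambda>m. dist (u m $ i) (x $ i)) \<longlonglongrightarrow> 0"
    by (rule tendsto_sandwich[rotated 3]) (auto simp: component_le)
  then show ?thesis
    by (simp add: tendsto_dist_iff[symmetric])
qed

lemma component_Cauchy:
  assumes "\<And>e. e > 0 \<Longrightarrow> \<exists>N. \<forall>m\<ge>N. \<forall>k. D (u m) (u (m + k)) < e"
  shows "Cauchy (\<lambda>m. u m $ i)"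
proof (rule CauchyI')
  fix e :: real
  assume "e > 0"
  then have "e / real CARD('n) > 0"
    by simp
  from assms[OF this] obtain N
    where N: "\<And>m k. m \<ge> N \<Longrightarrow> D (u m) (u (m + k)) < e / real CARD('n)"
    by blast
  have "dist (u m $ i) (u k $ i) < e" if "m \<ge> N" "m < k" for m k
  proof -
    have "D (u m) (u k) < e / real CARD('n)"
      using N[of m "k - m"] that by simp
    then have "real CARD('n) * D (u m) (u k) < e"
      by (simp add: field_simps)
    then show ?thesis
      using component_le[where x = "u m" and y = "u k" and i = i] by simp
  qed
  then show "\<exists>M. \<forall>m\<ge>M. \<forall>n>m. dist (u m $ i) (u n $ i) < e"
    by blast
qed

end

lemma tuple_distance_mean:
  "tuple_distance (\<lambda>x y :: 'a::metric_space ^ 'n::finite.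
     1 / real CARD('n) * (\<Sum>i\<in>UNIV. dist (x $ i) (y $ i)))"
proof
  fix x y z :: "'a ^ 'n" and i :: 'n
  let ?S = "\<lambda>x y :: 'a ^ 'n. \<Sum>i\<in>UNIV. dist (x $ i) (y $ i)"
  show "1 / real CARD('n) * ?S x y = 1 / real CARD('n) * ?S y x"
    by (simp add: dist_commute)
  have "?S x z \<le> ?S x y + ?S y z"
    unfolding sum.distrib[symmetric] by (intro sum_mono dist_triangle)
  then show "1 / real CARD('n) * ?S x z
      \<le> 1 / real CARD('n) * ?S x y + 1 / real CARD('n) * ?S y z"
    by (simp add: add_divide_distrib[symmetric] divide_right_mono)
  have "?S x y \<ge> 0"
    by (simp add: sum_nonneg)
  moreover have "real CARD('n) \<ge> 1"
    by (simp add: Suc_leI)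
  ultimately show "1 / real CARD('n) * ?S x y \<le> ?S x y"
    by (simp add: divide_le_eq mult_le_cancel_left1 order_trans)
  have "dist (x $ i) (y $ i) \<le> ?S x y"
    by (rule member_le_sum) auto
  then show "dist (x $ i) (y $ i) \<le> real CARD('n) * (1 / real CARD('n) * ?S x y)"
    by simp
qed

lemma tuple_distance_Max:
  "tuple_distance (\<lambda>x y :: 'a::metric_space ^ 'n::finite. MAX i\<in>UNIV. dist (x $ i) (y $ i))"
proof
  fix x y z :: "'a ^ 'n" and i :: 'n
  let ?M = "\<lambda>x y :: 'a ^ 'n. MAX i\<in>UNIV. dist (x $ i) (y $ i)"
  have le: "dist (x $ j) (y $ j) \<le> ?M x y" for x y :: "'a ^ 'n" and j
    by (rule Max_ge) auto
  show "?M x y = ?M y x"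
    by (simp add: dist_commute)
  show "?M x z \<le> ?M x y + ?M y z"
  proof (rule Max.boundedI)
    fix a assume "a \<in> range (\<lambda>i. dist (x $ i) (z $ i))"
    then obtain j where "a = dist (x $ j) (z $ j)"
      by auto
    then show "a \<le> ?M x y + ?M y z"
      using dist_triangle[of "x $ j" "z $ j" "y $ j"] le[of x j y] le[of y j z] by linarith
  qed auto
  show "?M x y \<le> (\<Sum>i\<in>UNIV. dist (x $ i) (y $ i))"
    by (rule Max.boundedI) (auto intro!: member_le_sum)
  have "0 \<le> ?M x y"
    using order_trans[OF zero_le_dist le] .
  moreover have "real CARD('n) \<ge> 1"
    by (simp add: Suc_leI)
  ultimately have "?M x y \<le> real CARD('n) * ?M x y"
    by (simp add: mult_le_cancel_right1)
  then show "dist (x $ i) (y $ i) \<le> real CARD('n) * ?M x y"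
    using le[of x i y] by linarith
qed

section \<open>Coincidence points\<close>

lemma reindex_nth: "reindex ast i x $ k = x $ ast i k"
  by (simp add: reindex_def)

lemma O_completeE:
  assumes "O_complete E" "\<And>m. u m \<in> E" "monoseq u" "Cauchy u"
  obtains x where "x \<in> E" "u \<longlonglongrightarrow> x"
  using assms unfolding O_complete_def by blast

text \<open>
  The relation \<open>R\<close> is the order or its converse, so that increasing and decreasing
  iterations are treated at once.
\<close>

lemma g_monotoneD:
  assumes "g_monotone F g" "R = (\<le>) \<or> R = (\<ge>)" "\<And>i. R (g (x $ i)) (g (y $ i))"
  shows "R (F x) (F y)"
  using assms unfolding g_monotone_def by auto

lemma MCB_propertyD:
  assumes "MCB_property g E" "R = (\<le>) \<or> R = (\<ge>)" "\<And>m. u m \<in> E" "x \<in> E"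
    and "\<And>m k. m \<le> k \<Longrightarrow> R (u m) (u k)" "u \<longlonglongrightarrow> x"
  shows "R (g (u m)) (g x)"
proof (cases "R = (\<le>)")
  case True
  then have "incr_lim u x"
    using assms(5,6) unfolding incr_lim_def incseq_def by simp
  then show ?thesis
    using assms(1,3,4) True unfolding MCB_property_def by blast
next
  case False
  then have "R = (\<ge>)"
    using assms(2) by blast
  moreover from this have "decr_lim u x"
    using assms(5,6) unfolding decr_lim_def decseq_def by simp
  ultimately show ?thesis
    using assms(1,3,4) unfolding MCB_property_def by blast
qed

lemma chain_monoseq:
  assumes "R = (\<le>) \<or> R = (\<ge>)" "\<And>m k. m \<le> k \<Longrightarrow> R (u m) (u k)"
  shows "monoseq u"
  using assms unfolding monoseq_def by auto

lemma lift_Suc_chain: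
  assumes "R = (\<le>) \<or> R = (\<ge>)" "\<And>m. R (u m) (u (Suc m))" "m \<le> k"
  shows "R (u m) (u k :: 'a::order)"
  using assms(1)
proof
  assume "R = (\<le>)"
  then show ?thesis using lift_Suc_mono_le[of u m k] assms(2,3) by simp
next
  assume "R = (\<ge>)"
  then show ?thesis using lift_Suc_antimono_le[of u m k] assms(2,3) by simp
qed

text \<open>
  A function in \<open>Omega\<close> may have a positive value at \<open>0\<close>.  That value may be replaced by \<open>0\<close>:
  by antisymmetry, tuples with equal \<open>g\<close>-images have equal \<open>F\<close>-images.
\<close>

lemma contraction_upd_zero:
  fixes F :: "'a::{metric_space,order} ^ 'n::finite \<Rightarrow> 'a"
  assumes dist: "tuple_distance D"
    and mono: "g_monotone F g"
    and contr: "D (\<chi> i. F (reindex ast i x)) (\<chi> i. F (reindex ast i y))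
      \<le> \<phi> (D (\<chi> i. g (x $ i)) (\<chi> i. g (y $ i)))"
  shows "D (\<chi> i. F (reindex ast i x)) (\<chi> i. F (reindex ast i y))
      \<le> (\<phi>(0 := 0)) (D (\<chi> i. g (x $ i)) (\<chi> i. g (y $ i)))"
proof (cases "D (\<chi> i. g (x $ i)) (\<chi> i. g (y $ i)) = 0")
  case True
  interpret tuple_distance D by (rule dist)
  from True have eq: "g (x $ i) = g (y $ i)" for i
    by (simp add: eq_zero_iff vec_eq_iff)
  have "F (reindex ast i x) = F (reindex ast i y)" for i
    using mono unfolding g_monotone_def by (simp add: eq reindex_def order_antisym)
  then show ?thesis
    using True by (simp add: self)
next
  case False
  then show ?thesis
    using contr by simp
qed

lemma exists_coincidence_iteration:
  fixes F :: "'a ^ 'n::finite \<Rightarrow> 'a"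
  assumes "range F \<subseteq> range g"
  obtains x where "x 0 = x0" "\<And>m i. g (x (Suc m) $ i) = F (reindex ast i (x m))"
proof -
  have "\<exists>y :: 'a ^ 'n. \<forall>i. g (y $ i) = F (reindex ast i x)" for x
  proof -
    have "F (reindex ast i x) \<in> range g" for i
      using assms by blast
    then have "\<forall>i. \<exists>b. g b = F (reindex ast i x)"
      by (metis rangeE)
    then obtain b where "\<forall>i. g (b i) = F (reindex ast i x)"
      by metis
    then show ?thesis
      by (intro exI[of _ "\<chi> i. b i"]) simp
  qed
  then obtain S :: "'a ^ 'n \<Rightarrow> 'a ^ 'n" where S: "\<And>x i. g (S x $ i) = F (reindex ast i x)"
    by metis
  show thesis
    by (rule that[of "rec_nat x0 (\<lambda>_. S)"]) (simp_all add: S)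
qed

text \<open>
  The limit \<open>z\<close> of the iterates \<open>y m = G (x m)\<close> is the coincidence point: the sequences
  \<open>F (reindex ast i (y m))\<close> tend to \<open>g (z $ i)\<close> by compatibility and to \<open>F (reindex ast i z)\<close>
  by either alternative in the continuity hypothesis.
\<close>

lemma coincidence_point_of_contraction:
  fixes F :: "'a::{metric_space,order} ^ 'n::finite \<Rightarrow> 'a"
  assumes dist: "tuple_distance D"
    and complete: "O_complete E"
    and range: "range F \<subseteq> range g \<inter> E"
    and mono: "g_monotone F g"
    and compat: "O_compatible ast F g"
    and gcont: "O_continuous g"
    and cont_or_MCB: "O_continuous_tuple F \<or> MCB_property g E"
    and R: "R = (\<le>) \<or> R = (\<ge>)"
    and start: "\<And>i. R (g (x0 $ i)) (F (reindex ast i x0))"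
    and Omega: "\<phi> \<in> Omega"
    and contraction: "\<And>x y. (\<forall>i. g (x $ i) \<le> g (y $ i)) \<or> (\<forall>i. g (x $ i) \<ge> g (y $ i)) \<Longrightarrow>
      D (\<chi> i. F (reindex ast i x)) (\<chi> i. F (reindex ast i y))
        \<le> \<phi> (D (\<chi> i. g (x $ i)) (\<chi> i. g (y $ i)))"
  shows "\<exists>x. coincidence_point ast F g x"
proof -
  interpret tuple_distance D by (rule dist)
  define \<psi> where "\<psi> = \<phi>(0 := 0)"
  have psi: "\<psi> \<in> Omega" "\<psi> 0 = 0"
    using Omega_upd_zero[OF Omega] unfolding \<psi>_def by auto
  have contr: "D (\<chi> i. F (reindex ast i x)) (\<chi> i. F (reindex ast i y))
      \<le> \<psi> (D (\<chi> i. g (x $ i)) (\<chi> i. g (y $ i)))"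
    if "\<And>i. R (g (x $ i)) (g (y $ i))" for x y
    unfolding \<psi>_def
  proof (rule contraction_upd_zero[OF dist mono])
    show "D (\<chi> i. F (reindex ast i x)) (\<chi> i. F (reindex ast i y))
        \<le> \<phi> (D (\<chi> i. g (x $ i)) (\<chi> i. g (y $ i)))"
      by (rule contraction) (use R that in auto)
  qed

  obtain x where x0: "x 0 = x0" and x: "\<And>m i. g (x (Suc m) $ i) = F (reindex ast i (x m))"
    using exists_coincidence_iteration[of F g x0 ast] range by auto
  define y where "y m = (\<chi> i. g (x m $ i))" for m
  have y_Suc: "y (Suc m) = (\<chi> i. F (reindex ast i (x m)))" for m
    unfolding y_def x ..
  have "R (g (x m $ i)) (g (x (Suc m) $ i))" for m i
  proof (induction m arbitrary: i)
    case 0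
    show ?case using start x x0 by simp
  next
    case (Suc m)
    have "R (F (reindex ast i (x m))) (F (reindex ast i (x (Suc m))))"
      by (rule g_monotoneD[OF mono R]) (unfold reindex_nth, rule Suc.IH)
    then show ?case
      unfolding x .
  qed
  then have chain: "R (y m $ i) (y k $ i)" if "m \<le> k" for m k i
    using lift_Suc_chain[OF R, of "\<lambda>m. y m $ i"] that by (simp add: y_def)

  have "\<exists>N. \<forall>m\<ge>N. \<forall>k. D (y m) (y (m + k)) < e" if "e > 0" for e
  proof (rule comparison_contraction_Cauchy[OF nonneg self sym triangle psi _ that])
    show "D (y (Suc m)) (y (Suc k)) \<le> \<psi> (D (y m) (y k))" if "m \<le> k" for m k
      unfolding y_Suc unfolding y_def
      by (rule contr) (use chain[OF that] in \<open>simp add: y_def\<close>)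
  qed
  then have Cauchy: "Cauchy (\<lambda>m. y m $ i)" for i
    by (rule component_Cauchy)
  \<comment> \<open>The starting value \<open>y 0\<close> need not lie in \<open>E\<close>; all later ones are values of \<open>F\<close>.\<close>
  have y_in: "y (Suc m) $ i \<in> E" for m i
    using range unfolding y_Suc by auto
  have "\<exists>b\<in>E. (\<lambda>m. y (Suc m) $ i) \<longlonglongrightarrow> b" for i
  proof -
    have "monoseq (\<lambda>m. y (Suc m) $ i)"
      by (rule chain_monoseq[OF R]) (simp add: chain)
    moreover have "Cauchy (\<lambda>m. y (Suc m) $ i)"
      using Cauchy_subseq_Cauchy[OF Cauchy, of Suc i] by (simp add: strict_mono_Suc_iff o_def)
    ultimately show ?thesis
      using O_completeE[OF complete, of "\<lambda>m. y (Suc m) $ i"] y_in by blast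
  qed
  then obtain b where b: "\<And>i. b i \<in> E" "\<And>i. (\<lambda>m. y (Suc m) $ i) \<longlonglongrightarrow> b i"
    by metis
  define z where "z = (\<chi> i. b i)"
  have z_in: "z $ i \<in> E" and lim_Suc: "(\<lambda>m. y (Suc m) $ i) \<longlonglongrightarrow> z $ i" for i
    using b unfolding z_def by auto
  have lim: "(\<lambda>m. y m $ i) \<longlonglongrightarrow> z $ i" for i
    using lim_Suc by (rule LIMSEQ_imp_Suc)
  have y_lim: "mono_lim (\<lambda>m. y m $ i) (z $ i)" and y_lim_Suc: "mono_lim (\<lambda>m. y (Suc m) $ i) (z $ i)"
    for i
    unfolding mono_lim_def using lim lim_Suc by (auto intro!: chain_monoseq[OF R] chain)

  have to_g: "(\<lambda>m. F (reindex ast i (y m))) \<longlonglongrightarrow> g (z $ i)" for i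
  proof -
    have "(\<lambda>m. g (y (Suc m) $ i)) \<longlonglongrightarrow> g (z $ i)"
      using gcont y_lim_Suc unfolding O_continuous_def by blast
    then have "(\<lambda>m. g (F (reindex ast i (x m)))) \<longlonglongrightarrow> g (z $ i)"
      by (simp add: y_Suc)
    \<comment> \<open>The components of \<open>y\<close> and their shifts are the two sequences with common limits in the
      definition of compatibility.\<close>
    moreover have "(\<lambda>m. dist (g (F (reindex ast i (x m)))) (F (reindex ast i (y m)))) \<longlonglongrightarrow> 0"
      using compat[unfolded O_compatible_def, rule_format, of x z i] y_lim y_lim_Suc
      unfolding y_Suc unfolding y_def by simp
    ultimately have "(\<lambda>m. dist (g (F (reindex ast i (x m)))) (F (reindex ast i (y m)))
        + dist (g (F (reindex ast i (x m)))) (g (z $ i))) \<longlonglongrightarrow> 0"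
      by (intro tendsto_add_zero) (simp_all add: tendsto_dist_iff[symmetric])
    then have "(\<lambda>m. dist (F (reindex ast i (y m))) (g (z $ i))) \<longlonglongrightarrow> 0"
      by (rule tendsto_sandwich[OF _ _ tendsto_const, rotated 2]) (auto simp: dist_triangle3)
    then show ?thesis
      by (simp add: tendsto_dist_iff[symmetric])
  qed
  have to_F: "(\<lambda>m. F (reindex ast i (y (Suc m)))) \<longlonglongrightarrow> F (reindex ast i z)" for i
    using cont_or_MCB
  proof
    assume "O_continuous_tuple F"
    moreover have "mono_lim (\<lambda>m. reindex ast i (y (Suc m)) $ k) (reindex ast i z $ k)" for k
      using y_lim_Suc[of "ast i k"] by (simp add: reindex_def)
    ultimately show ?thesis
      unfolding O_continuous_tuple_def
      by (elim allE[of _ "\<lambda>m. reindex ast i (y (Suc m))"] allE[of _ "reindex ast i z"]) simp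
  next
    assume MCB: "MCB_property g E"
    have comparable: "R (g (y (Suc m) $ i)) (g (z $ i))" for m i
      by (rule MCB_propertyD[OF MCB R, of "\<lambda>m. y (Suc m) $ i"])
        (auto simp: y_in z_in lim_Suc chain)
    have "(\<lambda>m. D (\<chi> i. g (y (Suc m) $ i)) (\<chi> i. g (z $ i))) \<longlonglongrightarrow> 0"
      using gcont y_lim_Suc unfolding O_continuous_def by (intro tendsto_zero) simp
    then have "(\<lambda>m. D (\<chi> i. F (reindex ast i (y (Suc m)))) (\<chi> i. F (reindex ast i z))) \<longlonglongrightarrow> 0"
    proof (rule tendsto_sandwich[OF _ _ tendsto_const, rotated 2])
      show "\<forall>\<^sub>F m in sequentially. D (\<chi> i. F (reindex ast i (y (Suc m)))) (\<chi> i. F (reindex ast i z))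
          \<le> D (\<chi> i. g (y (Suc m) $ i)) (\<chi> i. g (z $ i))"
        using order_trans[OF contr[OF comparable] Omega_le[OF psi nonneg]]
        by (intro always_eventually allI)
    qed (simp add: nonneg)
    from component_tendsto[OF this, of i] show ?thesis
      by simp
  qed
  have "F (reindex ast i z) = g (z $ i)" for i
    using LIMSEQ_unique[OF to_F LIMSEQ_Suc[OF to_g]] .
  then show ?thesis
    unfolding coincidence_point_def by blast
qed

theorem theorem3:
  fixes E :: "'a::{metric_space,order} set"
    and ast :: "'n::finite \<Rightarrow> 'n \<Rightarrow> 'n"
    and F :: "'a ^ 'n \<Rightarrow> 'a"
    and g :: "'a \<Rightarrow> 'a"
  assumes "CARD('n) \<ge> 2"
    and "E \<noteq> {}"
    and "O_complete E"
    and "range F \<subseteq> range g \<inter> E"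
    and "g_monotone F g"
    and "O_compatible ast F g"
    and "O_continuous g"
    and "O_continuous_tuple F \<or> MCB_property g E"
    and "\<exists>x0 :: 'a ^ 'n. (\<forall>i. g (x0 $ i) \<le> F (reindex ast i x0)) \<or>
                         (\<forall>i. g (x0 $ i) \<ge> F (reindex ast i x0))"
    and "(\<exists>\<phi>\<in>Omega. \<forall>x y :: 'a ^ 'n.
            (\<forall>i. g (x $ i) \<le> g (y $ i)) \<or> (\<forall>i. g (x $ i) \<ge> g (y $ i)) \<longrightarrow>
            1 / real CARD('n) * (\<Sum>i\<in>UNIV. dist (F (reindex ast i x)) (F (reindex ast i y)))
              \<le> \<phi> (1 / real CARD('n) * (\<Sum>i\<in>UNIV. dist (g (x $ i)) (g (y $ i))))) \<or>
         (\<exists>\<phi>\<in>Omega. \<forall>x y :: 'a ^ 'n.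
            (\<forall>i. g (x $ i) \<le> g (y $ i)) \<or> (\<forall>i. g (x $ i) \<ge> g (y $ i)) \<longrightarrow>
            (MAX i\<in>UNIV. dist (F (reindex ast i x)) (F (reindex ast i y)))
              \<le> \<phi> (MAX i\<in>UNIV. dist (g (x $ i)) (g (y $ i))))"
  shows "\<exists>x :: 'a ^ 'n. coincidence_point ast F g x"
proof -
  obtain x0 :: "'a ^ 'n" and R where R: "R = (\<le>) \<or> R = (\<ge>)"
    and start: "\<And>i. R (g (x0 $ i)) (F (reindex ast i x0))"
  proof -
    obtain x0 :: "'a ^ 'n" where "(\<forall>i. g (x0 $ i) \<le> F (reindex ast i x0)) \<or>
        (\<forall>i. g (x0 $ i) \<ge> F (reindex ast i x0))"
      using assms(9) by blast
    then show thesis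
      using that[of "(\<le>)" x0] that[of "(\<ge>)" x0] by auto
  qed
  from assms(10) show ?thesis
  proof (elim disjE bexE)
    fix \<phi>
    assume Omega: "\<phi> \<in> Omega" and contraction: "\<forall>x y :: 'a ^ 'n.
            (\<forall>i. g (x $ i) \<le> g (y $ i)) \<or> (\<forall>i. g (x $ i) \<ge> g (y $ i)) \<longrightarrow>
            1 / real CARD('n) * (\<Sum>i\<in>UNIV. dist (F (reindex ast i x)) (F (reindex ast i y)))
              \<le> \<phi> (1 / real CARD('n) * (\<Sum>i\<in>UNIV. dist (g (x $ i)) (g (y $ i))))"
    show ?thesis
      by (rule coincidence_point_of_contraction
          [OF tuple_distance_mean assms(3-8) R start Omega])
        (unfold vec_lambda_beta, use contraction in blast)
  next
    fix \<phi>
    assume Omega: "\<phi> \<in> Omega" and contraction: "\<forall>x y :: 'a ^ 'n.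
            (\<forall>i. g (x $ i) \<le> g (y $ i)) \<or> (\<forall>i. g (x $ i) \<ge> g (y $ i)) \<longrightarrow>
            (MAX i\<in>UNIV. dist (F (reindex ast i x)) (F (reindex ast i y)))
              \<le> \<phi> (MAX i\<in>UNIV. dist (g (x $ i)) (g (y $ i)))"
    show ?thesis
      by (rule coincidence_point_of_contraction
          [OF tuple_distance_Max assms(3-8) R start Omega])
        (unfold vec_lambda_beta, use contraction in blast)
  qed
qed

end
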